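(* For any $\mathcal{ALC}\iota$ concept $C$ (and, optionally, any $\mathcal{ALC}\iota$ ontology $\mathcal{O}$), if the tableau procedure $\mathtt{TAB}_{\mathcal{ALC}\iota}$ returns sat on input $C$ (resp. $C$ and $\mathcal{O}$), then $C$ is satisfiable (resp. satisfiable with respect to $\mathcal{O}$, i.e. $C^{\mathcal{I}}\neq\emptyset$ for some model $\mathcal{I}$ of $\mathcal{O}$).
   Context: $\mathcal{ALC}\iota$ concepts: $C ::= A \mid \neg C \mid (C\sqcap C) \mid \exists r.C \mid \{\iota C\} \mid \iota C.C$, semantics standard for $\neg,\sqcap,\exists r$; $(\{\iota C\})^{\mathcal{I}}=\{d\}$ if $C^{\mathcal{I}}=\{d\}$, else $\emptyset$; $(\iota C.D)^{\mathcal{I}}=\Delta^{\mathcal{I}}$ if $C^{\mathcal{I}}=\{d\}\subseteq D^{\mathcal{I}}$ for some $d$, else $\emptyset$. An ontology consists of a TBox (concept inclusions) and an ABox (assertions $a:C$, $r:(a,b)$). Procedure $\mathtt{TAB}_{\mathcal{ALC}\iota}$: builds a tree of assertions whose root contains $a:C$, $a$ not in $\mathcal{O}$. A branch (root-to-leaf path, treated as a set of assertions) is closed if it contains $\bot$, open otherwise. A rule $\frac{Pr}{Con_1\mid\cdots\mid Con_m}$ is applicable to $Pr$ if not blocked, no $Con_i$ is already on the branch, and the branch is open; applying it splits the branch into $m$ extensions. Rules are applied exhaustively ($(\bot)$ highest, $(\exists r)$ lowest priority); a branch is saturated if open with no applicable rule; output is sat if some open saturated branch exists, unsat if all branches close.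 Rules ($b,b'$ fresh individuals; $A^g_C$, $A_C$ fresh atomic concepts determined by $C$): $(ABox_{\mathsf I})$: if $a:C\in$ABox add $a:C$; $(ABox_r)$: if $r(a,a')\in$ABox add $r(a,a')$; $(TBox)$: from $C\sqsubseteq D\in$TBox and $a:E$ add $a:\neg(C\sqcap\neg D)$; $(\bot)$: $a:C,a:\neg C\Rightarrow\bot$; $(\neg\neg)$: $a:\neg\neg C\Rightarrow a:C$; $(\sqcap)$: $a:C\sqcap D\Rightarrow a:C,a:D$; $(\neg\sqcap)$: $a:\neg(C\sqcap D)\Rightarrow a:\neg C\mid a:\neg D$; $(\exists r)$: $a:\exists r.C\Rightarrow b:C,r:(a,b)$, blocked if some individual $a'$ on the branch has $a':C$ and $a':\neg D$ for every $D$ with $a:\neg\exists r.D$ on the branch; $(\neg\exists r)$: $a:\neg\exists r.C,r:(a,a')\Rightarrow a':\neg C$; $(\iota^g_1)$: $a:\iota C.D\Rightarrow b:C,b:D$, except that if some individual already satisfies $C$ only $D$ is added to the lexicographically least such; $(\iota^g_2)$: $a:\iota C.D,a':C,a'':C,a':E\Rightarrow a'':E$; $(\neg\iota^g)$: $a:\neg\iota C.D,a':E\Rightarrow a':\neg C\mid a':\neg D\mid b:C,b:A^g_C,b':C,b':\neg A^g_C$, and once the third alternative has been taken, further applications to $x:\neg\iota C.E$ are blocked; $(cut^g_\iota)$: $a:\iota C.D,a':E\Rightarrow a':C\mid a':\neg C$; $(\iota^\ell_1)$: $a:\{\iota C\}\Rightarrow a:C$; $(\iota^\ell_2)$: $a:\{\iota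 C\},a':C,a'':C,a':D\Rightarrow a'':D$; $(\neg\iota^\ell)$: $a:\neg\{\iota C\}\Rightarrow a:\neg C\mid a:\neg A_C,b:C,b:A_C$ (in the right alternative only $a:\neg A_C$ is added if an individual already satisfies $C$ and $A_C$); $(cut^\ell_\iota)$: $a:\{\iota C\},a':D\Rightarrow a':C\mid a':\neg C$.
   Formalization: In (TBox), (¬ι^g) and both cut rules, a premise a:E whose E is not used in the conclusion is read as "a occurs on the branch", in a concept or role assertion; read literally the claim fails, e.g. for ABox {r:(b,c)}, TBox {∃r.⊤ ⊑ ⊥}, C = A. *)

theory Defs
  imports Main
begin

section \<open>Syntax\<close>

text \<open>The linear order of \<^typ>\<open>String.literal\<close> is the lexicographic one.\<close>

type_synonym cname = String.literal
type_synonym rname = String.literal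
type_synonym iname = String.literal

datatype concept =
    Atom cname
  | Neg concept
  | Conj concept concept
  | Exists rname concept
  | LDesc concept            \<comment> \<open>\<open>{\<iota>C}\<close>\<close>
  | GDesc concept concept    \<comment> \<open>\<open>\<iota>C.D\<close>\<close>

datatype assertion =
    ConceptAssertion iname concept
  | RoleAssertion rname iname iname

record ontology =
  tbox :: "(concept \<times> concept) set"    \<comment> \<open>\<open>(C, D)\<close> stands for the inclusion of \<open>C\<close> in \<open>D\<close>\<close>
  abox :: "assertion set"

definition empty_ontology :: ontology where
  "empty_ontology = \<lparr>tbox = {}, abox = {}\<rparr>"

primrec atoms :: "concept \<Rightarrow> cname set" where
  "atoms (Atom A) = {A}"
| "atoms (Neg C) = atoms C"
| "atoms (Conj C D) = atoms C \<union> atoms D"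
| "atoms (Exists r C) = atoms C"
| "atoms (LDesc C) = atoms C"
| "atoms (GDesc C D) = atoms C \<union> atoms D"

primrec assertion_atoms :: "assertion \<Rightarrow> cname set" where
  "assertion_atoms (ConceptAssertion a C) = atoms C"
| "assertion_atoms (RoleAssertion r a b) = {}"

primrec assertion_inds :: "assertion \<Rightarrow> iname set" where
  "assertion_inds (ConceptAssertion a C) = {a}"
| "assertion_inds (RoleAssertion r a b) = {a, b}"

definition ontology_atoms :: "ontology \<Rightarrow> cname set" where
  "ontology_atoms \<O> = (\<Union>(C, D)\<in>tbox \<O>. atoms C \<union> atoms D) \<union> (\<Union>\<alpha>\<in>abox \<O>. assertion_atoms \<alpha>)"

definition ontology_inds :: "ontology \<Rightarrow> iname set" where
  "ontology_inds \<O> = (\<Union>\<alpha>\<in>abox \<O>. assertion_inds \<alpha>)"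


section \<open>Semantics\<close>

record 'd interp =
  dom :: "'d set"
  cint :: "cname \<Rightarrow> 'd set"
  rint :: "rname \<Rightarrow> ('d \<times> 'd) set"
  iint :: "iname \<Rightarrow> 'd"

definition interpretation_wf :: "'d interp \<Rightarrow> bool" where
  "interpretation_wf I \<longleftrightarrow>
     dom I \<noteq> {} \<and> (\<forall>A. cint I A \<subseteq> dom I) \<and> (\<forall>r. rint I r \<subseteq> dom I \<times> dom I) \<and> (\<forall>a. iint I a \<in> dom I)"

primrec ext :: "'d interp \<Rightarrow> concept \<Rightarrow> 'd set" where
  "ext I (Atom A) = cint I A"
| "ext I (Neg C) = dom I - ext I C"
| "ext I (Conj C D) = ext I C \<inter> ext I D"
| "ext I (Exists r C) = {d \<in> dom I. \<exists>e. (d, e) \<in> rint I r \<and> e \<in> ext I C}"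
| "ext I (LDesc C) = (if \<exists>d. ext I C = {d} then ext I C else {})"
| "ext I (GDesc C D) = (if \<exists>d. ext I C = {d} \<and> {d} \<subseteq> ext I D then dom I else {})"

primrec satisfies :: "'d interp \<Rightarrow> assertion \<Rightarrow> bool" where
  "satisfies I (ConceptAssertion a C) \<longleftrightarrow> iint I a \<in> ext I C"
| "satisfies I (RoleAssertion r a b) \<longleftrightarrow> (iint I a, iint I b) \<in> rint I r"

definition model_of :: "'d interp \<Rightarrow> ontology \<Rightarrow> bool" where
  "model_of I \<O> \<longleftrightarrow>
     interpretation_wf I \<and> (\<forall>(C, D)\<in>tbox \<O>. ext I C \<subseteq> ext I D) \<and> (\<forall>\<alpha>\<in>abox \<O>. satisfies I \<alpha>)"

text \<open>HOL cannot quantify existentially over the type of domain elements. Domains range over the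
  nonempty sets of natural numbers, so an interpretation obtained below is in particular one in the
  usual sense.\<close>

definition satisfiable :: "concept \<Rightarrow> bool" where
  "satisfiable C \<longleftrightarrow> (\<exists>I :: nat interp. interpretation_wf I \<and> ext I C \<noteq> {})"

definition satisfiable_wrt :: "ontology \<Rightarrow> concept \<Rightarrow> bool" where
  "satisfiable_wrt \<O> C \<longleftrightarrow> (\<exists>I :: nat interp. model_of I \<O> \<and> ext I C \<noteq> {})"


section \<open>The tableau procedure\<close>

datatype entry = Assertion assertion | Clash

type_synonym branch = "entry set"

abbreviation conc :: "iname \<Rightarrow> concept \<Rightarrow> entry" where
  "conc a C \<equiv> Assertion (ConceptAssertion a C)"

abbreviation role :: "rname \<Rightarrow> iname \<Rightarrow> iname \<Rightarrow> entry" where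
  "role r a b \<equiv> Assertion (RoleAssertion r a b)"

definition branch_inds :: "branch \<Rightarrow> iname set" where
  "branch_inds B = (\<Union>\<alpha>\<in>{\<alpha>. Assertion \<alpha> \<in> B}. assertion_inds \<alpha>)"

definition fresh :: "ontology \<Rightarrow> branch \<Rightarrow> iname \<Rightarrow> bool" where
  "fresh \<O> B b \<longleftrightarrow> b \<notin> branch_inds B \<and> b \<notin> ontology_inds \<O>"

text \<open>\<open>gm C\<close> and \<open>lm C\<close> are the fresh atomic concepts attached to \<open>C\<close> by the rules for negated
  global and negated local descriptions.\<close>

definition fresh_markers :: "ontology \<Rightarrow> concept \<Rightarrow> (concept \<Rightarrow> cname) \<Rightarrow> (concept \<Rightarrow> cname) \<Rightarrow> bool" where
  "fresh_markers \<O> C gm lm \<longleftrightarrow>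
     inj gm \<and> inj lm \<and> range gm \<inter> range lm = {} \<and>
     (range gm \<union> range lm) \<inter> (atoms C \<union> ontology_atoms \<O>) = {}"

datatype rule =
    ABoxI | ABoxR | TBoxRule | Bot | NegNeg | ConjRule | NegConj | ExRule | NegExRule
  | GIota1 | GIota2 | NegGIota | GCut | LIota1 | LIota2 | NegLIota | LCut

text \<open>\<open>rule_inst \<O> gm lm B \<rho> Ks\<close>: the premises of an instance of \<open>\<rho>\<close> are available on \<open>B\<close>, the instance
  is not blocked, and \<open>Ks\<close> lists its alternatives. A premise \<open>a:E\<close> whose concept \<open>E\<close> is not used in
  the conclusion only says that the individual is present; it is rendered by \<open>a \<in> branch_inds B\<close>, so
  that it also covers individuals of the ABox that occur in role assertions only.

  In \<open>NegGIota\<close>, that the third alternative has been taken for \<open>C\<close> can be read off the branch as a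
  set, because \<open>gm C\<close> is introduced by that alternative only.\<close>

inductive rule_inst ::
  "ontology \<Rightarrow> (concept \<Rightarrow> cname) \<Rightarrow> (concept \<Rightarrow> cname) \<Rightarrow> branch \<Rightarrow> rule \<Rightarrow> entry set list \<Rightarrow> bool"
  for \<O> gm lm B
where
  ABoxI: "ConceptAssertion a C \<in> abox \<O> \<Longrightarrow>
    rule_inst \<O> gm lm B ABoxI [{conc a C}]"
| ABoxR: "RoleAssertion r a a' \<in> abox \<O> \<Longrightarrow>
    rule_inst \<O> gm lm B ABoxR [{role r a a'}]"
| TBox: "(C, D) \<in> tbox \<O> \<Longrightarrow> a \<in> branch_inds B \<Longrightarrow>
    rule_inst \<O> gm lm B TBoxRule [{conc a (Neg (Conj C (Neg D)))}]"
| Bot: "conc a C \<in> B \<Longrightarrow> conc a (Neg C) \<in> B \<Longrightarrow>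
    rule_inst \<O> gm lm B Bot [{Clash}]"
| NegNeg: "conc a (Neg (Neg C)) \<in> B \<Longrightarrow>
    rule_inst \<O> gm lm B NegNeg [{conc a C}]"
| Conj: "conc a (Conj C D) \<in> B \<Longrightarrow>
    rule_inst \<O> gm lm B ConjRule [{conc a C, conc a D}]"
| NegConj: "conc a (Neg (Conj C D)) \<in> B \<Longrightarrow>
    rule_inst \<O> gm lm B NegConj [{conc a (Neg C)}, {conc a (Neg D)}]"
| Ex: "conc a (Exists r C) \<in> B \<Longrightarrow> fresh \<O> B b \<Longrightarrow>
    \<not> (\<exists>a'. conc a' C \<in> B \<and> (\<forall>D. conc a (Neg (Exists r D)) \<in> B \<longrightarrow> conc a' (Neg D) \<in> B)) \<Longrightarrow>
    rule_inst \<O> gm lm B ExRule [{conc b C, role r a b}]"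
| NegEx: "conc a (Neg (Exists r C)) \<in> B \<Longrightarrow> role r a a' \<in> B \<Longrightarrow>
    rule_inst \<O> gm lm B NegExRule [{conc a' (Neg C)}]"
| GIota1_new: "conc a (GDesc C D) \<in> B \<Longrightarrow> \<not> (\<exists>a'. conc a' C \<in> B) \<Longrightarrow> fresh \<O> B b \<Longrightarrow>
    rule_inst \<O> gm lm B GIota1 [{conc b C, conc b D}]"
| GIota1_old: "conc a (GDesc C D) \<in> B \<Longrightarrow> conc a' C \<in> B \<Longrightarrow>
    (\<And>a''. conc a'' C \<in> B \<Longrightarrow> a' \<le> a'') \<Longrightarrow>
    rule_inst \<O> gm lm B GIota1 [{conc a' D}]"
| GIota2: "conc a (GDesc C D) \<in> B \<Longrightarrow> conc a' C \<in> B \<Longrightarrow> conc a'' C \<in> B \<Longrightarrow> conc a' E \<in> B \<Longrightarrow>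
    rule_inst \<O> gm lm B GIota2 [{conc a'' E}]"
| NegGIota: "conc a (Neg (GDesc C D)) \<in> B \<Longrightarrow> a' \<in> branch_inds B \<Longrightarrow>
    fresh \<O> B b \<Longrightarrow> fresh \<O> B b' \<Longrightarrow> b \<noteq> b' \<Longrightarrow>
    \<not> (\<exists>x x'. conc x C \<in> B \<and> conc x (Atom (gm C)) \<in> B \<and>
              conc x' C \<in> B \<and> conc x' (Neg (Atom (gm C))) \<in> B) \<Longrightarrow>
    rule_inst \<O> gm lm B NegGIota
      [{conc a' (Neg C)}, {conc a' (Neg D)},
       {conc b C, conc b (Atom (gm C)), conc b' C, conc b' (Neg (Atom (gm C)))}]"
| GCut: "conc a (GDesc C D) \<in> B \<Longrightarrow> a' \<in> branch_inds B \<Longrightarrow>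
    rule_inst \<O> gm lm B GCut [{conc a' C}, {conc a' (Neg C)}]"
| LIota1: "conc a (LDesc C) \<in> B \<Longrightarrow>
    rule_inst \<O> gm lm B LIota1 [{conc a C}]"
| LIota2: "conc a (LDesc C) \<in> B \<Longrightarrow> conc a' C \<in> B \<Longrightarrow> conc a'' C \<in> B \<Longrightarrow> conc a' D \<in> B \<Longrightarrow>
    rule_inst \<O> gm lm B LIota2 [{conc a'' D}]"
| NegLIota_new: "conc a (Neg (LDesc C)) \<in> B \<Longrightarrow>
    \<not> (\<exists>x. conc x C \<in> B \<and> conc x (Atom (lm C)) \<in> B) \<Longrightarrow> fresh \<O> B b \<Longrightarrow>
    rule_inst \<O> gm lm B NegLIota
      [{conc a (Neg C)}, {conc a (Neg (Atom (lm C))), conc b C, conc b (Atom (lm C))}]"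
| NegLIota_old: "conc a (Neg (LDesc C)) \<in> B \<Longrightarrow>
    \<exists>x. conc x C \<in> B \<and> conc x (Atom (lm C)) \<in> B \<Longrightarrow>
    rule_inst \<O> gm lm B NegLIota [{conc a (Neg C)}, {conc a (Neg (Atom (lm C)))}]"
| LCut: "conc a (LDesc C) \<in> B \<Longrightarrow> a' \<in> branch_inds B \<Longrightarrow>
    rule_inst \<O> gm lm B LCut [{conc a' C}, {conc a' (Neg C)}]"

definition open_branch :: "branch \<Rightarrow> bool" where
  "open_branch B \<longleftrightarrow> Clash \<notin> B"

definition applicable ::
  "ontology \<Rightarrow> (concept \<Rightarrow> cname) \<Rightarrow> (concept \<Rightarrow> cname) \<Rightarrow> branch \<Rightarrow> rule \<Rightarrow> entry set list \<Rightarrow> bool" where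
  "applicable \<O> gm lm B \<rho> Ks \<longleftrightarrow>
     rule_inst \<O> gm lm B \<rho> Ks \<and> (\<forall>K\<in>set Ks. \<not> K \<subseteq> B) \<and> open_branch B"

definition saturated :: "ontology \<Rightarrow> (concept \<Rightarrow> cname) \<Rightarrow> (concept \<Rightarrow> cname) \<Rightarrow> branch \<Rightarrow> bool" where
  "saturated \<O> gm lm B \<longleftrightarrow> open_branch B \<and> (\<nexists>\<rho> Ks. applicable \<O> gm lm B \<rho> Ks)"

definition rank :: "rule \<Rightarrow> nat" where
  "rank \<rho> = (if \<rho> = Bot then 0 else if \<rho> = ExRule then 2 else 1)"

definition next_rule ::
  "ontology \<Rightarrow> (concept \<Rightarrow> cname) \<Rightarrow> (concept \<Rightarrow> cname) \<Rightarrow> branch \<Rightarrow> rule \<Rightarrow> entry set list \<Rightarrow> bool" where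
  "next_rule \<O> gm lm B \<rho> Ks \<longleftrightarrow>
     applicable \<O> gm lm B \<rho> Ks \<and> (\<forall>\<rho>' Ks'. applicable \<O> gm lm B \<rho>' Ks' \<longrightarrow> rank \<rho> \<le> rank \<rho>')"

datatype tree = Node (label: "entry set") (children: "tree list")

text \<open>A branch is the set of all entries on a path from the root to a leaf.\<close>

primrec branches :: "tree \<Rightarrow> branch set" where
  "branches (Node L ts) = (if ts = [] then {L} else (\<Union>X\<in>set (map branches ts). (\<union>) L ` X))"

text \<open>\<open>grown \<O> gm lm B t\<close>: \<open>t\<close> is produced by rule applications below a node whose path from the root,
  including the node itself, carries the entries \<open>B\<close>.\<close>

inductive grown :: "ontology \<Rightarrow> (concept \<Rightarrow> cname) \<Rightarrow> (concept \<Rightarrow> cname) \<Rightarrow> branch \<Rightarrow> tree \<Rightarrow> bool"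
  for \<O> gm lm
where
  leaf: "grown \<O> gm lm B (Node L [])"
| split: "next_rule \<O> gm lm B \<rho> Ks \<Longrightarrow>
    list_all2 (\<lambda>K t. label t = K \<and> grown \<O> gm lm (B \<union> K) t) Ks ts \<Longrightarrow>
    grown \<O> gm lm B (Node L ts)"

definition tableau ::
  "ontology \<Rightarrow> (concept \<Rightarrow> cname) \<Rightarrow> (concept \<Rightarrow> cname) \<Rightarrow> iname \<Rightarrow> concept \<Rightarrow> tree \<Rightarrow> bool" where
  "tableau \<O> gm lm a C t \<longleftrightarrow> label t = {conc a C} \<and> grown \<O> gm lm {conc a C} t"

text \<open>The choice of the fresh names and of the next rule among those of equal priority is left open;
  the procedure returns sat if some way of resolving these choices leads to an open saturated branch.\<close>

definition tab_returns_sat :: "ontology \<Rightarrow> concept \<Rightarrow> bool" where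
  "tab_returns_sat \<O> C \<longleftrightarrow>
     (\<exists>gm lm a t. fresh_markers \<O> C gm lm \<and> a \<notin> ontology_inds \<O> \<and> tableau \<O> gm lm a C t \<and>
        (\<exists>B\<in>branches t. saturated \<O> gm lm B))"

end

theory Submission
  imports Defs "HOL-Library.Countable_Set"
begin

text \<open>A model is read off an open saturated branch by identifying individuals that satisfy the same
  concepts on it: its elements are the resulting sets of concepts, the types. The rules \<open>LIota2\<close>
  and \<open>GIota2\<close> together with the cut rules put all individuals satisfying a described concept into
  one type, while the markers introduced for negated descriptions keep the witnesses of
  non-uniqueness in different types. Roles are interpreted as largely as the negated existential
  restrictions permit, so that a blocked existential restriction is witnessed by the type of the
  blocking individual. Since the branch is finite, fresh individuals never run out, and a
  generating rule can be inapplicable only because it is blocked or already satisfied.\<close>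

section \<open>Semantics\<close>

lemma ext_subset_dom: "interpretation_wf I \<Longrightarrow> ext I C \<subseteq> dom I"
  by (induction C) (auto simp: interpretation_wf_def)

lemma mem_ext_LDesc_iff: "d \<in> ext I (LDesc C) \<longleftrightarrow> ext I C = {d}"
  by auto

lemma mem_ext_GDesc_iff:
  "d \<in> ext I (GDesc C D) \<longleftrightarrow> d \<in> dom I \<and> (\<exists>e. ext I C = {e} \<and> e \<in> ext I D)"
  by simp

lemma ext_LDesc_eq: "ext I (LDesc C) = (if is_singleton (ext I C) then ext I C else {})"
  by (simp add: is_singleton_def)

lemma ext_GDesc_eq:
  "ext I (GDesc C D) = (if is_singleton (ext I C) \<and> ext I C \<subseteq> ext I D then dom I else {})"
  by (auto simp: is_singleton_def)

lemma ext_Neg_Conj_Neg_eq_dom_iff: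
  assumes "interpretation_wf I"
  shows "ext I (Neg (Conj C (Neg D))) = dom I \<longleftrightarrow> ext I C \<subseteq> ext I D"
  using ext_subset_dom[OF assms] by auto

lemma satisfiable_iff_satisfiable_wrt_empty: "satisfiable C \<longleftrightarrow> satisfiable_wrt empty_ontology C"
  by (simp add: satisfiable_def satisfiable_wrt_def model_of_def empty_ontology_def)

definition map_interp :: "('d \<Rightarrow> 'e) \<Rightarrow> 'd interp \<Rightarrow> 'e interp" where
  "map_interp h I =
     \<lparr>dom = h ` dom I, cint = (\<lambda>A. h ` cint I A), rint = (\<lambda>r. map_prod h h ` rint I r),
      iint = h \<circ> iint I\<rparr>"

lemma map_interp_simps [simp]:
  "dom (map_interp h I) = h ` dom I"
  "cint (map_interp h I) A = h ` cint I A"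
  "rint (map_interp h I) r = map_prod h h ` rint I r"
  "iint (map_interp h I) a = h (iint I a)"
  by (simp_all add: map_interp_def)

lemma interpretation_wf_map_interp: "interpretation_wf I \<Longrightarrow> interpretation_wf (map_interp h I)"
  by (fastforce simp: interpretation_wf_def)

lemma ext_map_interp:
  assumes wf: "interpretation_wf I" and inj: "inj_on h (dom I)"
  shows "ext (map_interp h I) C = h ` ext I C"
proof -
  have singleton: "is_singleton (h ` ext I D) \<longleftrightarrow> is_singleton (ext I D)" for D
    using inj_on_subset[OF inj ext_subset_dom[OF wf]] by (simp add: is_singleton_altdef card_image)
  have mem: "h d \<in> h ` ext I D \<longleftrightarrow> d \<in> ext I D" if "d \<in> dom I" for d D
    using inj that ext_subset_dom[OF wf] by (rule inj_on_image_mem_iff)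
  have subset: "h ` ext I D \<subseteq> h ` ext I E \<longleftrightarrow> ext I D \<subseteq> ext I E" for D E
    using mem ext_subset_dom[OF wf] by (simp add: image_subset_iff) blast
  show ?thesis
  proof (induction C)
    case (Atom A)
    show ?case by simp
  next
    case (Neg C)
    then show ?case using inj_on_image_set_diff[OF inj] ext_subset_dom[OF wf] by simp
  next
    case (Conj C D)
    then show ?case using inj_on_image_Int[OF inj] ext_subset_dom[OF wf] by simp
  next
    case (Exists r C)
    have "d \<in> dom I \<and> e \<in> ext I C" if "(d, e) \<in> rint I r" "h e \<in> h ` ext I C" for d e
    proof -
      have "d \<in> dom I" "e \<in> dom I" using wf that(1) by (auto simp: interpretation_wf_def)
      then show ?thesis using that(2) mem by blast
    qed
    then have "ext (map_interp h I) (Exists r C) \<subseteq> h ` ext I (Exists r C)"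
      unfolding ext.simps map_interp_simps Exists.IH by blast
    moreover have "h ` ext I (Exists r C) \<subseteq> ext (map_interp h I) (Exists r C)"
      unfolding ext.simps map_interp_simps Exists.IH by force
    ultimately show ?case by blast
  next
    case (LDesc C)
    then show ?case by (simp only: ext_LDesc_eq singleton) simp
  next
    case (GDesc C D)
    then show ?case by (simp only: ext_GDesc_eq singleton subset map_interp_simps) simp
  qed
qed

lemma model_of_map_interp:
  assumes model: "model_of I \<O>" and inj: "inj_on h (dom I)"
  shows "model_of (map_interp h I) \<O>"
proof -
  have wf: "interpretation_wf I" using model by (simp add: model_of_def)
  note ext_map = ext_map_interp[OF wf inj]
  have "satisfies (map_interp h I) \<alpha>" if "satisfies I \<alpha>" for \<alpha>
    using that by (cases \<alpha>) (auto simp: ext_map)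
  then show ?thesis
    using model interpretation_wf_map_interp[OF wf] by (fastforce simp: model_of_def ext_map)
qed

lemma satisfiable_wrt_if_countable_model:
  fixes I :: "'d interp"
  assumes model: "model_of I \<O>" and countable: "countable (dom I)"
    and nonempty: "ext I C \<noteq> {}"
  shows "satisfiable_wrt \<O> C"
proof -
  define h where "h = to_nat_on (dom I)"
  have inj: "inj_on h (dom I)" unfolding h_def using countable by (rule inj_on_to_nat_on)
  have "interpretation_wf I" using model by (simp add: model_of_def)
  then have "ext (map_interp h I) C \<noteq> {}" using nonempty by (simp add: ext_map_interp[OF _ inj])
  then show ?thesis using model_of_map_interp[OF model inj] by (auto simp: satisfiable_wrt_def)
qed

section \<open>Quasimodels\<close>

definition role_compatible :: "rname \<Rightarrow> concept set \<Rightarrow> concept set \<Rightarrow> bool" where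
  "role_compatible r \<sigma> \<tau> \<longleftrightarrow> (\<forall>D. Neg (Exists r D) \<in> \<sigma> \<longrightarrow> Neg D \<in> \<tau>)"

definition type_interp :: "concept set set \<Rightarrow> (iname \<Rightarrow> concept set) \<Rightarrow> concept set interp" where
  "type_interp T \<nu> =
     \<lparr>dom = T, cint = (\<lambda>A. {\<sigma> \<in> T. Atom A \<in> \<sigma>}),
      rint = (\<lambda>r. {(\<sigma>, \<tau>) \<in> T \<times> T. role_compatible r \<sigma> \<tau>}), iint = \<nu>\<rparr>"

lemma type_interp_simps [simp]:
  "dom (type_interp T \<nu>) = T"
  "cint (type_interp T \<nu>) A = {\<sigma> \<in> T. Atom A \<in> \<sigma>}"
  "rint (type_interp T \<nu>) r = {(\<sigma>, \<tau>) \<in> T \<times> T. role_compatible r \<sigma> \<tau>}"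
  "iint (type_interp T \<nu>) = \<nu>"
  by (simp_all add: type_interp_def)

locale quasimodel =
  fixes T :: "concept set set" and \<nu> :: "iname \<Rightarrow> concept set"
  assumes individual: "\<nu> a \<in> T"
    and consistent: "\<sigma> \<in> T \<Longrightarrow> C \<in> \<sigma> \<Longrightarrow> Neg C \<notin> \<sigma>"
    and neg_neg: "\<sigma> \<in> T \<Longrightarrow> Neg (Neg C) \<in> \<sigma> \<Longrightarrow> C \<in> \<sigma>"
    and conj: "\<sigma> \<in> T \<Longrightarrow> Conj C D \<in> \<sigma> \<Longrightarrow> C \<in> \<sigma> \<and> D \<in> \<sigma>"
    and neg_conj: "\<sigma> \<in> T \<Longrightarrow> Neg (Conj C D) \<in> \<sigma> \<Longrightarrow> Neg C \<in> \<sigma> \<or> Neg D \<in> \<sigma>"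
    and exists: "\<sigma> \<in> T \<Longrightarrow> Exists r C \<in> \<sigma> \<Longrightarrow> \<exists>\<tau>\<in>T. C \<in> \<tau> \<and> role_compatible r \<sigma> \<tau>"
    and ldesc: "\<sigma> \<in> T \<Longrightarrow> LDesc C \<in> \<sigma> \<Longrightarrow> C \<in> \<sigma> \<and> (\<forall>\<tau>\<in>T. \<tau> \<noteq> \<sigma> \<longrightarrow> Neg C \<in> \<tau>)"
    and neg_ldesc: "\<sigma> \<in> T \<Longrightarrow> Neg (LDesc C) \<in> \<sigma> \<Longrightarrow> Neg C \<in> \<sigma> \<or> (\<exists>\<tau>\<in>T. \<tau> \<noteq> \<sigma> \<and> C \<in> \<tau>)"
    and gdesc: "\<sigma> \<in> T \<Longrightarrow> GDesc C D \<in> \<sigma> \<Longrightarrow>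
      \<exists>\<tau>\<in>T. C \<in> \<tau> \<and> D \<in> \<tau> \<and> (\<forall>\<upsilon>\<in>T. \<upsilon> \<noteq> \<tau> \<longrightarrow> Neg C \<in> \<upsilon>)"
    and neg_gdesc: "\<sigma> \<in> T \<Longrightarrow> Neg (GDesc C D) \<in> \<sigma> \<Longrightarrow>
      (\<exists>\<tau>\<in>T. \<exists>\<upsilon>\<in>T. \<tau> \<noteq> \<upsilon> \<and> C \<in> \<tau> \<and> C \<in> \<upsilon>) \<or> (\<forall>\<tau>\<in>T. Neg C \<in> \<tau> \<or> Neg D \<in> \<tau>)"
begin

abbreviation canonical :: "concept set interp" where
  "canonical \<equiv> type_interp T \<nu>"

lemma interpretation_wf_canonical: "interpretation_wf canonical"
  using individual by (auto simp: interpretation_wf_def)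

lemma ext_canonical_subset: "ext canonical C \<subseteq> T"
  using ext_subset_dom[OF interpretation_wf_canonical] by simp

definition truthful :: "concept \<Rightarrow> bool" where
  "truthful C \<longleftrightarrow>
     (\<forall>\<sigma>\<in>T. (C \<in> \<sigma> \<longrightarrow> \<sigma> \<in> ext canonical C) \<and> (Neg C \<in> \<sigma> \<longrightarrow> \<sigma> \<notin> ext canonical C))"

lemma truthfulI:
  assumes "\<And>\<sigma>. \<sigma> \<in> T \<Longrightarrow> C \<in> \<sigma> \<Longrightarrow> \<sigma> \<in> ext canonical C"
    and "\<And>\<sigma>. \<sigma> \<in> T \<Longrightarrow> Neg C \<in> \<sigma> \<Longrightarrow> \<sigma> \<notin> ext canonical C"
  shows "truthful C"
  using assms by (simp add: truthful_def)

lemma truthfulD: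
  assumes "truthful C" "\<sigma> \<in> T"
  shows "C \<in> \<sigma> \<Longrightarrow> \<sigma> \<in> ext canonical C" "Neg C \<in> \<sigma> \<Longrightarrow> \<sigma> \<notin> ext canonical C"
  using assms by (simp_all add: truthful_def)

lemma truthful_imp_ext_eq_singleton:
  assumes "truthful C" "\<sigma> \<in> T" "C \<in> \<sigma>" "\<And>\<tau>. \<tau> \<in> T \<Longrightarrow> \<tau> \<noteq> \<sigma> \<Longrightarrow> Neg C \<in> \<tau>"
  shows "ext canonical C = {\<sigma>}"
  using assms truthfulD[of C] ext_canonical_subset by blast

lemma truthful_Atom: "truthful (Atom A)"
  by (rule truthfulI) (auto dest: consistent)

lemma truthful_Neg:
  assumes "truthful C"
  shows "truthful (Neg C)"
  by (rule truthfulI) (auto dest: neg_neg truthfulD[OF assms])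

lemma truthful_Conj:
  assumes "truthful C" "truthful D"
  shows "truthful (Conj C D)"
  by (rule truthfulI) (auto dest: conj neg_conj truthfulD[OF assms(1)] truthfulD[OF assms(2)])

lemma truthful_Exists:
  assumes "truthful C"
  shows "truthful (Exists r C)"
proof (rule truthfulI)
  fix \<sigma>
  assume \<sigma>: "\<sigma> \<in> T" "Exists r C \<in> \<sigma>"
  then obtain \<tau> where "\<tau> \<in> T" "C \<in> \<tau>" "role_compatible r \<sigma> \<tau>"
    using exists by blast
  then show "\<sigma> \<in> ext canonical (Exists r C)" using \<sigma>(1) truthfulD(1)[OF assms] by auto
next
  fix \<sigma>
  assume "\<sigma> \<in> T" "Neg (Exists r C) \<in> \<sigma>"
  then show "\<sigma> \<notin> ext canonical (Exists r C)"
    using truthfulD(2)[OF assms] by (auto simp: role_compatible_def)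
qed

lemma truthful_LDesc:
  assumes "truthful C"
  shows "truthful (LDesc C)"
proof (rule truthfulI)
  fix \<sigma>
  assume \<sigma>: "\<sigma> \<in> T" "LDesc C \<in> \<sigma>"
  have "ext canonical C = {\<sigma>}"
    using truthful_imp_ext_eq_singleton[OF assms \<sigma>(1)] ldesc[OF \<sigma>] by blast
  then show "\<sigma> \<in> ext canonical (LDesc C)" unfolding mem_ext_LDesc_iff .
next
  fix \<sigma>
  assume \<sigma>: "\<sigma> \<in> T" "Neg (LDesc C) \<in> \<sigma>"
  have "ext canonical C \<noteq> {\<sigma>}"
    using neg_ldesc[OF \<sigma>] truthfulD[OF assms] \<sigma>(1) by blast
  then show "\<sigma> \<notin> ext canonical (LDesc C)" unfolding mem_ext_LDesc_iff .
qed

lemma truthful_GDesc: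
  assumes C: "truthful C" and D: "truthful D"
  shows "truthful (GDesc C D)"
proof (rule truthfulI)
  fix \<sigma>
  assume \<sigma>: "\<sigma> \<in> T" "GDesc C D \<in> \<sigma>"
  obtain \<tau> where \<tau>: "\<tau> \<in> T" "C \<in> \<tau>" "D \<in> \<tau>"
    and others: "\<And>\<upsilon>. \<upsilon> \<in> T \<Longrightarrow> \<upsilon> \<noteq> \<tau> \<Longrightarrow> Neg C \<in> \<upsilon>"
    using gdesc[OF \<sigma>] by blast
  have "ext canonical C = {\<tau>}"
    using C \<tau>(1,2) others by (rule truthful_imp_ext_eq_singleton)
  moreover have "\<tau> \<in> ext canonical D" using truthfulD(1)[OF D \<tau>(1,3)] .
  ultimately show "\<sigma> \<in> ext canonical (GDesc C D)" using \<sigma>(1) by simp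
next
  fix \<sigma>
  assume \<sigma>: "\<sigma> \<in> T" "Neg (GDesc C D) \<in> \<sigma>"
  consider (distinct) \<upsilon>\<^sub>1 \<upsilon>\<^sub>2 where "\<upsilon>\<^sub>1 \<in> T" "\<upsilon>\<^sub>2 \<in> T" "\<upsilon>\<^sub>1 \<noteq> \<upsilon>\<^sub>2" "C \<in> \<upsilon>\<^sub>1" "C \<in> \<upsilon>\<^sub>2"
    | (excluded) "\<forall>\<tau>\<in>T. Neg C \<in> \<tau> \<or> Neg D \<in> \<tau>"
    using neg_gdesc[OF \<sigma>] by blast
  then have "ext canonical C \<noteq> {\<tau>} \<or> \<tau> \<notin> ext canonical D" for \<tau>
  proof cases
    case (distinct \<upsilon>\<^sub>1 \<upsilon>\<^sub>2)
    then have "\<upsilon>\<^sub>1 \<in> ext canonical C" "\<upsilon>\<^sub>2 \<in> ext canonical C" by (auto intro: truthfulD(1)[OF C])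
    with \<open>\<upsilon>\<^sub>1 \<noteq> \<upsilon>\<^sub>2\<close> show ?thesis by blast
  next
    case excluded
    have "\<tau> \<notin> ext canonical C \<or> \<tau> \<notin> ext canonical D" if "\<tau> \<in> T"
      using excluded truthfulD(2)[OF C that] truthfulD(2)[OF D that] that by blast
    then show ?thesis using ext_canonical_subset by blast
  qed
  then show "\<sigma> \<notin> ext canonical (GDesc C D)" by (simp only: mem_ext_GDesc_iff) blast
qed

lemma canonical_truth: "truthful C"
  by (induction C)
    (simp_all add: truthful_Atom truthful_Neg truthful_Conj truthful_Exists truthful_LDesc
      truthful_GDesc)

lemma model_of_canonical:
  assumes tbox: "\<And>C D \<sigma>. (C, D) \<in> tbox \<O> \<Longrightarrow> \<sigma> \<in> T \<Longrightarrow> Neg (Conj C (Neg D)) \<in> \<sigma>"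
    and concepts: "\<And>a C. ConceptAssertion a C \<in> abox \<O> \<Longrightarrow> C \<in> \<nu> a"
    and roles: "\<And>r a b. RoleAssertion r a b \<in> abox \<O> \<Longrightarrow> role_compatible r (\<nu> a) (\<nu> b)"
  shows "model_of canonical \<O>"
proof -
  have "ext canonical C \<subseteq> ext canonical D" if incl: "(C, D) \<in> tbox \<O>" for C D
  proof -
    have "T \<subseteq> ext canonical (Neg (Conj C (Neg D)))"
      using truthfulD(1)[OF canonical_truth _ tbox[OF incl]] by (rule subsetI)
    then have "ext canonical (Neg (Conj C (Neg D))) = dom canonical"
      using ext_canonical_subset by (simp only: type_interp_simps subset_antisym)
    then show ?thesis using ext_Neg_Conj_Neg_eq_dom_iff[OF interpretation_wf_canonical] by blast
  qed
  moreover have "satisfies canonical \<alpha>" if "\<alpha> \<in> abox \<O>" for \<alpha>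
    using that individual
    by (cases \<alpha>) (simp_all add: truthfulD(1)[OF canonical_truth] concepts roles)
  ultimately show ?thesis using interpretation_wf_canonical by (auto simp: model_of_def)
qed

end

section \<open>Saturated branches\<close>

lemma conc_branch_inds: "conc a C \<in> B \<Longrightarrow> a \<in> branch_inds B"
  unfolding branch_inds_def by force

lemma role_branch_inds:
  assumes "role r a b \<in> B"
  shows "a \<in> branch_inds B" "b \<in> branch_inds B"
  using assms unfolding branch_inds_def by force+

lemma finite_branch_inds:
  assumes "finite B"
  shows "finite (branch_inds B)"
proof -
  have "finite (Assertion -` B)"
    using assms by (rule finite_vimageI) (simp add: inj_def)
  moreover have "finite (assertion_inds \<alpha>)" for \<alpha>
    by (cases \<alpha>) auto
  ultimately show ?thesis
    by (simp add: branch_inds_def vimage_def)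
qed

lemma fresh_imp_conc_notin: "fresh \<O> B b \<Longrightarrow> conc b C \<notin> B"
  using conc_branch_inds by (auto simp: fresh_def)

definition concepts_at :: "branch \<Rightarrow> iname \<Rightarrow> concept set" where
  "concepts_at B a = {C. conc a C \<in> B}"

lemma mem_concepts_at [simp]: "C \<in> concepts_at B a \<longleftrightarrow> conc a C \<in> B"
  by (simp add: concepts_at_def)

lemma concepts_at_eqI:
  assumes "\<And>C. conc a C \<in> B \<Longrightarrow> conc b C \<in> B" "\<And>C. conc b C \<in> B \<Longrightarrow> conc a C \<in> B"
  shows "concepts_at B a = concepts_at B b"
  using assms by auto

definition branch_types :: "branch \<Rightarrow> concept set set" where
  "branch_types B = concepts_at B ` branch_inds B"

lemma branch_typesE:
  assumes "\<sigma> \<in> branch_types B"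
  obtains a where "a \<in> branch_inds B" "\<sigma> = concepts_at B a"
  using assms by (auto simp: branch_types_def)

lemma concepts_at_in_branch_types: "conc a C \<in> B \<Longrightarrow> concepts_at B a \<in> branch_types B"
  by (simp add: branch_types_def conc_branch_inds)

locale finite_saturated_branch =
  fixes \<O> :: ontology and gm lm :: "concept \<Rightarrow> cname" and B :: branch
  assumes saturated: "saturated \<O> gm lm B" and finite: "finite B"
begin

lemma rule_alternative:
  assumes "rule_inst \<O> gm lm B \<rho> Ks"
  obtains K where "K \<in> set Ks" "K \<subseteq> B"
  using assms saturated unfolding saturated_def applicable_def by blast

lemma conc_Neg_notin:
  assumes "conc a C \<in> B"
  shows "conc a (Neg C) \<notin> B"
proof
  assume "conc a (Neg C) \<in> B"
  from rule_alternative[OF rule_inst.Bot[OF assms this]] have "Clash \<in> B" by auto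
  then show False using saturated by (simp add: saturated_def open_branch_def)
qed

lemma concepts_at_neq:
  assumes "conc a C \<in> B" "conc b (Neg C) \<in> B"
  shows "concepts_at B a \<noteq> concepts_at B b"
  using assms conc_Neg_notin by (metis mem_concepts_at)

lemma abox_in_branch: "\<alpha> \<in> abox \<O> \<Longrightarrow> Assertion \<alpha> \<in> B"
  by (cases \<alpha>)
    (auto elim: rule_alternative[OF rule_inst.ABoxI] rule_alternative[OF rule_inst.ABoxR])

lemma obtain_fresh:
  assumes "finite X"
  obtains b where "fresh \<O> B b" "b \<notin> X"
proof -
  obtain b where b: "b \<notin> branch_inds B \<union> X"
    using ex_new_if_finite[OF infinite_literal] finite_branch_inds[OF finite] assms by blast
  moreover have "ontology_inds \<O> \<subseteq> branch_inds B"
    using abox_in_branch by (auto simp: ontology_inds_def branch_inds_def)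
  ultimately show thesis using that by (auto simp: fresh_def)
qed

lemma conc_ConjD:
  assumes "conc a (Conj C D) \<in> B"
  shows "conc a C \<in> B" "conc a D \<in> B"
  by (rule rule_alternative[OF rule_inst.Conj[OF assms]]; simp)+

lemma conc_Neg_ConjD:
  assumes "conc a (Neg (Conj C D)) \<in> B"
  shows "conc a (Neg C) \<in> B \<or> conc a (Neg D) \<in> B"
  by (rule rule_alternative[OF rule_inst.NegConj[OF assms]]) auto

lemma conc_Neg_NegD:
  assumes "conc a (Neg (Neg C)) \<in> B"
  shows "conc a C \<in> B"
  by (rule rule_alternative[OF rule_inst.NegNeg[OF assms]]) auto

lemma conc_tbox:
  assumes "(C, D) \<in> tbox \<O>" "a \<in> branch_inds B"
  shows "conc a (Neg (Conj C (Neg D))) \<in> B"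
  by (rule rule_alternative[OF rule_inst.TBox[OF assms]]) auto

lemma role_imp_compatible:
  assumes "role r a b \<in> B"
  shows "role_compatible r (concepts_at B a) (concepts_at B b)"
proof -
  have "conc b (Neg D) \<in> B" if "conc a (Neg (Exists r D)) \<in> B" for D
    by (rule rule_alternative[OF rule_inst.NegEx[OF that assms]]) auto
  then show ?thesis by (simp add: role_compatible_def)
qed

lemma conc_ExistsD:
  assumes "conc a (Exists r C) \<in> B"
  shows "\<exists>\<tau>\<in>branch_types B. C \<in> \<tau> \<and> role_compatible r (concepts_at B a) \<tau>"
proof (rule ccontr)
  assume none: "\<not> ?thesis"
  have "\<not> role_compatible r (concepts_at B a) (concepts_at B b)" if "conc b C \<in> B" for b
    using none that concepts_at_in_branch_types[OF that] mem_concepts_at by blast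
  then have unblocked:
    "\<not> (\<exists>b. conc b C \<in> B \<and> (\<forall>D. conc a (Neg (Exists r D)) \<in> B \<longrightarrow> conc b (Neg D) \<in> B))"
    unfolding role_compatible_def mem_concepts_at by blast
  obtain b where fresh: "fresh \<O> B b" using obtain_fresh[of "{}"] by blast
  from rule_alternative[OF rule_inst.Ex[OF assms fresh unblocked]] show False
    using fresh_imp_conc_notin[OF fresh] by auto
qed

lemma conc_LDescD:
  assumes "conc a (LDesc C) \<in> B"
  shows "conc a C \<in> B"
  by (rule rule_alternative[OF rule_inst.LIota1[OF assms]]) auto

lemma Neg_in_other_types:
  assumes copied: "\<And>x y E. conc x C \<in> B \<Longrightarrow> conc y C \<in> B \<Longrightarrow> conc x E \<in> B \<Longrightarrow> conc y E \<in> B"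
    and decided: "\<And>x. x \<in> branch_inds B \<Longrightarrow> conc x C \<in> B \<or> conc x (Neg C) \<in> B"
    and a: "conc a C \<in> B" and \<tau>: "\<tau> \<in> branch_types B" "\<tau> \<noteq> concepts_at B a"
  shows "Neg C \<in> \<tau>"
proof -
  obtain b where b: "b \<in> branch_inds B" "\<tau> = concepts_at B b" using \<tau>(1) by (rule branch_typesE)
  have "concepts_at B b = concepts_at B a" if "conc b C \<in> B"
    using copied[OF a that] copied[OF that a] by (intro concepts_at_eqI)
  then show ?thesis using decided[OF b(1)] b(2) \<tau>(2) by auto
qed

lemma conc_LDesc_unique:
  assumes desc: "conc a (LDesc C) \<in> B" and \<tau>: "\<tau> \<in> branch_types B" "\<tau> \<noteq> concepts_at B a"
  shows "Neg C \<in> \<tau>"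
proof (rule Neg_in_other_types[OF _ _ conc_LDescD[OF desc] \<tau>])
  show "conc y E \<in> B" if "conc x C \<in> B" "conc y C \<in> B" "conc x E \<in> B" for x y E
    by (rule rule_alternative[OF rule_inst.LIota2[OF desc that]]) auto
  show "conc x C \<in> B \<or> conc x (Neg C) \<in> B" if "x \<in> branch_inds B" for x
    by (rule rule_alternative[OF rule_inst.LCut[OF desc that]]) auto
qed

lemma conc_Neg_LDescD:
  assumes "conc a (Neg (LDesc C)) \<in> B"
  shows "conc a (Neg C) \<in> B \<or> (\<exists>\<tau>\<in>branch_types B. \<tau> \<noteq> concepts_at B a \<and> C \<in> \<tau>)"
proof (cases "\<exists>b. conc b C \<in> B \<and> conc b (Atom (lm C)) \<in> B")
  case True
  then obtain b where b: "conc b C \<in> B" "conc b (Atom (lm C)) \<in> B" by blast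
  have "conc a (Neg C) \<in> B \<or> conc a (Neg (Atom (lm C))) \<in> B"
    by (rule rule_alternative[OF rule_inst.NegLIota_old[where lm = lm, OF assms True]]) auto
  moreover have "concepts_at B b \<noteq> concepts_at B a" if "conc a (Neg (Atom (lm C))) \<in> B"
    using b(2) that by (rule concepts_at_neq)
  moreover have "concepts_at B b \<in> branch_types B" "C \<in> concepts_at B b"
    using b(1) by (simp_all add: concepts_at_in_branch_types)
  ultimately show ?thesis by blast
next
  case False
  obtain b where fresh: "fresh \<O> B b" using obtain_fresh[of "{}"] by blast
  from rule_alternative[OF rule_inst.NegLIota_new[where lm = lm, OF assms False fresh]]
  show ?thesis using fresh_imp_conc_notin[OF fresh] by auto
qed

lemma conc_GDesc_witness:
  assumes desc: "conc a (GDesc C D) \<in> B"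
  obtains b where "conc b C \<in> B" "conc b D \<in> B"
proof -
  define X where "X = {b. conc b C \<in> B}"
  have "X \<noteq> {}"
  proof
    assume "X = {}"
    then have none: "\<nexists>b. conc b C \<in> B" by (simp add: X_def)
    obtain b where fresh: "fresh \<O> B b" using obtain_fresh[of "{}"] by blast
    from rule_alternative[OF rule_inst.GIota1_new[OF desc none fresh]] none show False by auto
  qed
  moreover have "finite X"
    using conc_branch_inds finite_branch_inds[OF finite]
    by (auto simp: X_def intro: finite_subset[of _ "branch_inds B"])
  ultimately have least: "conc (Min X) C \<in> B" "\<And>b. conc b C \<in> B \<Longrightarrow> Min X \<le> b"
    using Min_in[of X] by (auto simp: X_def)
  from rule_alternative[OF rule_inst.GIota1_old[OF desc least]] have "conc (Min X) D \<in> B" by auto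
  with least(1) show thesis by (rule that)
qed

lemma conc_GDesc_unique:
  assumes desc: "conc a (GDesc C D) \<in> B" and b: "conc b C \<in> B"
    and \<tau>: "\<tau> \<in> branch_types B" "\<tau> \<noteq> concepts_at B b"
  shows "Neg C \<in> \<tau>"
proof (rule Neg_in_other_types[OF _ _ b \<tau>])
  show "conc y E \<in> B" if "conc x C \<in> B" "conc y C \<in> B" "conc x E \<in> B" for x y E
    by (rule rule_alternative[OF rule_inst.GIota2[OF desc that]]) auto
  show "conc x C \<in> B \<or> conc x (Neg C) \<in> B" if "x \<in> branch_inds B" for x
    by (rule rule_alternative[OF rule_inst.GCut[OF desc that]]) auto
qed

lemma conc_GDescD:
  assumes "conc a (GDesc C D) \<in> B"
  shows "\<exists>\<tau>\<in>branch_types B. C \<in> \<tau> \<and> D \<in> \<tau> \<and> (\<forall>\<upsilon>\<in>branch_types B. \<upsilon> \<noteq> \<tau> \<longrightarrow> Neg C \<in> \<upsilon>)"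
proof -
  obtain b where b: "conc b C \<in> B" "conc b D \<in> B" using assms by (rule conc_GDesc_witness)
  show ?thesis
  proof (intro bexI conjI ballI impI)
    show "concepts_at B b \<in> branch_types B" using b(1) by (rule concepts_at_in_branch_types)
  qed (use b conc_GDesc_unique[OF assms b(1)] in simp_all)
qed

lemma conc_Neg_GDescD:
  assumes desc: "conc a (Neg (GDesc C D)) \<in> B"
  shows "(\<exists>\<tau>\<in>branch_types B. \<exists>\<upsilon>\<in>branch_types B. \<tau> \<noteq> \<upsilon> \<and> C \<in> \<tau> \<and> C \<in> \<upsilon>) \<or>
    (\<forall>\<tau>\<in>branch_types B. Neg C \<in> \<tau> \<or> Neg D \<in> \<tau>)"
proof (cases "\<exists>b c. conc b C \<in> B \<and> conc b (Atom (gm C)) \<in> B \<and>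
              conc c C \<in> B \<and> conc c (Neg (Atom (gm C))) \<in> B")
  case True
  then obtain b c where bc: "conc b C \<in> B" "conc c C \<in> B"
    and marked: "conc b (Atom (gm C)) \<in> B" "conc c (Neg (Atom (gm C))) \<in> B" by blast
  have "concepts_at B b \<noteq> concepts_at B c" using marked by (rule concepts_at_neq)
  moreover have "C \<in> concepts_at B b" "C \<in> concepts_at B c" using bc by simp_all
  moreover note concepts_at_in_branch_types[OF bc(1)] concepts_at_in_branch_types[OF bc(2)]
  ultimately show ?thesis by blast
next
  case False
  obtain x where x: "fresh \<O> B x" using obtain_fresh[of "{}"] by blast
  obtain y where y: "fresh \<O> B y" "x \<noteq> y" using obtain_fresh[of "{x}"] by blast
  have "conc b (Neg C) \<in> B \<or> conc b (Neg D) \<in> B" if b: "b \<in> branch_inds B" for b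
    using rule_alternative[OF rule_inst.NegGIota[where gm = gm, OF desc b x y False]]
      fresh_imp_conc_notin[OF x] by auto
  then show ?thesis by (auto simp: branch_types_def)
qed

lemma quasimodel_branch_types:
  assumes "range \<nu> \<subseteq> branch_types B"
  shows "quasimodel (branch_types B) \<nu>"
proof
  show "\<nu> a \<in> branch_types B" for a
    using assms by blast
  show "Neg C \<notin> \<sigma>" if "\<sigma> \<in> branch_types B" "C \<in> \<sigma>" for \<sigma> C
    using that by (elim branch_typesE) (simp add: conc_Neg_notin)
  show "C \<in> \<sigma>" if "\<sigma> \<in> branch_types B" "Neg (Neg C) \<in> \<sigma>" for \<sigma> C
    using that by (auto elim!: branch_typesE dest: conc_Neg_NegD)
  show "C \<in> \<sigma> \<and> D \<in> \<sigma>" if "\<sigma> \<in> branch_types B" "Conj C D \<in> \<sigma>" for \<sigma> C D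
    using that by (auto elim!: branch_typesE dest: conc_ConjD)
  show "Neg C \<in> \<sigma> \<or> Neg D \<in> \<sigma>" if "\<sigma> \<in> branch_types B" "Neg (Conj C D) \<in> \<sigma>" for \<sigma> C D
    using that by (auto elim!: branch_typesE dest: conc_Neg_ConjD)
  show "\<exists>\<tau>\<in>branch_types B. C \<in> \<tau> \<and> role_compatible r \<sigma> \<tau>"
    if "\<sigma> \<in> branch_types B" "Exists r C \<in> \<sigma>" for \<sigma> r C
    using that by (elim branch_typesE) (simp add: conc_ExistsD)
  show "C \<in> \<sigma> \<and> (\<forall>\<tau>\<in>branch_types B. \<tau> \<noteq> \<sigma> \<longrightarrow> Neg C \<in> \<tau>)"
    if "\<sigma> \<in> branch_types B" "LDesc C \<in> \<sigma>" for \<sigma> C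
    using that by (elim branch_typesE) (simp add: conc_LDescD conc_LDesc_unique)
  show "Neg C \<in> \<sigma> \<or> (\<exists>\<tau>\<in>branch_types B. \<tau> \<noteq> \<sigma> \<and> C \<in> \<tau>)"
    if "\<sigma> \<in> branch_types B" "Neg (LDesc C) \<in> \<sigma>" for \<sigma> C
    using that by (elim branch_typesE) (simp add: conc_Neg_LDescD)
  show "\<exists>\<tau>\<in>branch_types B. C \<in> \<tau> \<and> D \<in> \<tau> \<and> (\<forall>\<upsilon>\<in>branch_types B. \<upsilon> \<noteq> \<tau> \<longrightarrow> Neg C \<in> \<upsilon>)"
    if "\<sigma> \<in> branch_types B" "GDesc C D \<in> \<sigma>" for \<sigma> C D
    using that by (elim branch_typesE) (simp add: conc_GDescD)
  show "(\<exists>\<tau>\<in>branch_types B. \<exists>\<upsilon>\<in>branch_types B. \<tau> \<noteq> \<upsilon> \<and> C \<in> \<tau> \<and> C \<in> \<upsilon>) \<or>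
      (\<forall>\<tau>\<in>branch_types B. Neg C \<in> \<tau> \<or> Neg D \<in> \<tau>)"
    if "\<sigma> \<in> branch_types B" "Neg (GDesc C D) \<in> \<sigma>" for \<sigma> C D
    using that by (elim branch_typesE) (simp add: conc_Neg_GDescD)
qed

lemma satisfiable_wrt_if_conc:
  assumes root: "conc a C \<in> B"
  shows "satisfiable_wrt \<O> C"
proof -
  define \<nu> where "\<nu> b = concepts_at B (if b \<in> branch_inds B then b else a)" for b
  have on_branch: "\<nu> b = concepts_at B b" if "b \<in> branch_inds B" for b
    using that by (simp add: \<nu>_def)
  have "range \<nu> \<subseteq> branch_types B"
    using conc_branch_inds[OF root] by (auto simp: \<nu>_def branch_types_def)
  then interpret quasimodel "branch_types B" \<nu> by (rule quasimodel_branch_types)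
  have "model_of canonical \<O>"
  proof (rule model_of_canonical)
    fix D E \<sigma>
    assume "(D, E) \<in> tbox \<O>" "\<sigma> \<in> branch_types B"
    then show "Neg (Conj D (Neg E)) \<in> \<sigma>" using conc_tbox by (auto simp: branch_types_def)
  next
    fix b D
    assume "ConceptAssertion b D \<in> abox \<O>"
    then have "conc b D \<in> B" by (rule abox_in_branch)
    then show "D \<in> \<nu> b" using conc_branch_inds by (simp add: on_branch)
  next
    fix r b c
    assume "RoleAssertion r b c \<in> abox \<O>"
    then have "role r b c \<in> B" by (rule abox_in_branch)
    then show "role_compatible r (\<nu> b) (\<nu> c)"
      using role_branch_inds role_imp_compatible by (simp add: on_branch)
  qed
  moreover have "countable (dom canonical)"
    using finite_branch_inds[OF finite] by (simp add: branch_types_def countable_finite)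
  moreover have "ext canonical C \<noteq> {}"
    using truthfulD(1)[OF canonical_truth individual[of a]] root conc_branch_inds[OF root]
    by (auto simp: on_branch)
  ultimately show ?thesis by (rule satisfiable_wrt_if_countable_model)
qed

end

section \<open>Soundness of the tableau procedure\<close>

lemma label_subset_branch: "X \<in> branches t \<Longrightarrow> label t \<subseteq> X"
  by (cases t) (auto split: if_splits)

lemma finite_rule_alternative:
  assumes "rule_inst \<O> gm lm B \<rho> Ks" "K \<in> set Ks"
  shows "finite K"
  using assms by cases auto

lemma finite_grown_branch:
  assumes "grown \<O> gm lm B t" "finite (label t)" "X \<in> branches t"
  shows "finite X"
  using assms
proof (induction arbitrary: X rule: grown.induct)
  case (leaf B L)
  then show ?case by simp
next
  case (split B \<rho> Ks ts L)
  show ?case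
  proof (cases "ts = []")
    case True
    then show ?thesis using split.prems by simp
  next
    case False
    then obtain t Y where t: "t \<in> set ts" and Y: "Y \<in> branches t" and X: "X = L \<union> Y"
      using split.prems by auto
    have alternative: "label t \<in> set Ks"
      and IH: "\<And>Y. finite (label t) \<Longrightarrow> Y \<in> branches t \<Longrightarrow> finite Y"
      using split.IH t by (auto simp: list_all2_conv_all_nth in_set_conv_nth)
    have "finite (label t)"
      using split.hyps alternative
      by (auto simp: next_rule_def applicable_def intro: finite_rule_alternative)
    then show ?thesis using IH Y X split.prems by simp
  qed
qed

lemma satisfiable_wrt_if_tab_returns_sat:
  assumes "tab_returns_sat \<O> C"
  shows "satisfiable_wrt \<O> C"
proof -
  obtain gm lm a t B where "tableau \<O> gm lm a C t" and B: "B \<in> branches t"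
    and saturated: "saturated \<O> gm lm B"
    using assms by (auto simp: tab_returns_sat_def)
  then have label: "label t = {conc a C}" and grown: "grown \<O> gm lm {conc a C} t"
    by (simp_all add: tableau_def)
  have "finite B" using finite_grown_branch[OF grown _ B] label by simp
  with saturated interpret finite_saturated_branch \<O> gm lm B by unfold_locales
  have "conc a C \<in> B" using label_subset_branch[OF B] label by simp
  then show ?thesis by (rule satisfiable_wrt_if_conc)
qed

theorem theorem7:
  fixes C :: concept and \<O> :: ontology
  shows "(tab_returns_sat empty_ontology C \<longrightarrow> satisfiable C) \<and>
         (tab_returns_sat \<O> C \<longrightarrow> satisfiable_wrt \<O> C)"
  using satisfiable_wrt_if_tab_returns_sat by (simp add: satisfiable_iff_satisfiable_wrt_empty)

end
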